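(* Let $z=f(x,y)$ be a real analytic solution to the minimal surface equation $$(1+f_y^2)f_{xx}-2f_xf_yf_{xy}+(1+f_x^2)f_{yy}=0$$ in $\mathbb{E}^3(x,y,z)$. If $f$ is even (resp. odd) with respect to both the $x$ and $y$ axes, i.e. $f(-x,y)=f(x,y)=f(x,-y)$ (resp. $f(-x,y)=-f(x,y)=f(x,-y)$), then its Wick rotation $t=g(x,y)=f(ix,iy)$ (resp. $t=g(x,y)=-f(ix,iy)$) is a real solution to the zero mean curvature equation $$(1-g_y^2)g_{xx}+2g_xg_yg_{xy}+(1-g_x^2)g_{yy}=0$$ in $\mathbb{L}^3(t,x,y)$ which is spacelike at least near the origin $o=(0,0)$.
   Context: $\mathbb{L}^3(t,x,y)$ is Lorentz-Minkowski 3-space with metric $-(dt)^2+(dx)^2+(dy)^2$. The graph $t=g(x,y)$ is spacelike where its induced metric is Riemannian, i.e. where $1-g_x^2-g_y^2>0$. Wick rotation: $f$ is real analytic on a (connected) domain containing the origin and symmetric under $x\mapsto-x$ and $y\mapsto-y$. For real $(x,y)$ near the origin, $f(ix,iy)$ denotes the value obtained by substituting $ix$, $iy$ for $x$, $y$ in the Taylor expansion of $f$ at the origin (analytic continuation). *)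

theory Defs
  imports "HOL-Analysis.Analysis"
begin

definition d1 :: "(real \<Rightarrow> real \<Rightarrow> real) \<Rightarrow> real \<Rightarrow> real \<Rightarrow> real" where
  "d1 f x y = deriv (\<lambda>u. f u y) x"

definition d2 :: "(real \<Rightarrow> real \<Rightarrow> real) \<Rightarrow> real \<Rightarrow> real \<Rightarrow> real" where
  "d2 f x y = deriv (\<lambda>v. f x v) y"

text \<open>The classes \<open>C\<^sup>1\<close> and \<open>C\<^sup>2\<close>; used for open sets \<open>U\<close> only.\<close>

definition C1_on :: "(real \<times> real) set \<Rightarrow> (real \<Rightarrow> real \<Rightarrow> real) \<Rightarrow> bool" where
  "C1_on U g \<longleftrightarrow>
     (\<forall>(x, y)\<in>U. (\<lambda>u. g u y) field_differentiable at x \<and> (\<lambda>v. g x v) field_differentiable at y) \<and>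
     continuous_on U (\<lambda>(x, y). d1 g x y) \<and> continuous_on U (\<lambda>(x, y). d2 g x y)"

definition C2_on :: "(real \<times> real) set \<Rightarrow> (real \<Rightarrow> real \<Rightarrow> real) \<Rightarrow> bool" where
  "C2_on U g \<longleftrightarrow> C1_on U g \<and> C1_on U (d1 g) \<and> C1_on U (d2 g)"

text \<open>\<open>has_sum\<close> is unconditional, hence absolute, convergence of the double series.\<close>

definition real_analytic_on :: "(real \<times> real) set \<Rightarrow> (real \<Rightarrow> real \<Rightarrow> real) \<Rightarrow> bool" where
  "real_analytic_on D f \<longleftrightarrow>
     (\<forall>(x0, y0)\<in>D. \<exists>(a :: nat \<Rightarrow> nat \<Rightarrow> real) r. r > 0 \<and>
        (\<forall>x y. \<bar>x - x0\<bar> < r \<longrightarrow> \<bar>y - y0\<bar> < r \<longrightarrow>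
           ((\<lambda>(j, k). a j k * (x - x0) ^ j * (y - y0) ^ k) has_sum f x y) UNIV))"

definition minimal_surface_eq :: "(real \<Rightarrow> real \<Rightarrow> real) \<Rightarrow> real \<Rightarrow> real \<Rightarrow> bool" where
  "minimal_surface_eq f x y \<longleftrightarrow>
     (1 + (d2 f x y)\<^sup>2) * d1 (d1 f) x y - 2 * d1 f x y * d2 f x y * d2 (d1 f) x y
       + (1 + (d1 f x y)\<^sup>2) * d2 (d2 f) x y = 0"

definition zero_mean_curvature_eq :: "(real \<Rightarrow> real \<Rightarrow> real) \<Rightarrow> real \<Rightarrow> real \<Rightarrow> bool" where
  "zero_mean_curvature_eq g x y \<longleftrightarrow>
     (1 - (d2 g x y)\<^sup>2) * d1 (d1 g) x y + 2 * d1 g x y * d2 g x y * d2 (d1 g) x y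
       + (1 - (d1 g x y)\<^sup>2) * d2 (d2 g) x y = 0"

definition zmc_solution_on :: "(real \<times> real) set \<Rightarrow> (real \<Rightarrow> real \<Rightarrow> real) \<Rightarrow> bool" where
  "zmc_solution_on U g \<longleftrightarrow> C2_on U g \<and> (\<forall>(x, y)\<in>U. zero_mean_curvature_eq g x y)"

text \<open>Lorentz-Minkowski space with coordinates \<open>(t, x, y)\<close>.\<close>

definition lorentz_metric :: "real \<times> real \<times> real \<Rightarrow> real \<times> real \<times> real \<Rightarrow> real" where
  "lorentz_metric p q = (case p of (t, x, y) \<Rightarrow> case q of (t', x', y') \<Rightarrow>
     - (t * t') + x * x' + y * y')"

text \<open>The graph \<open>t = g(x, y)\<close> has tangent vectors \<open>u (g\<^sub>x, 1, 0) + v (g\<^sub>y, 0, 1)\<close>; it is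
  spacelike where the induced metric is positive definite.\<close>

definition graph_tangent ::
    "(real \<Rightarrow> real \<Rightarrow> real) \<Rightarrow> real \<Rightarrow> real \<Rightarrow> real \<times> real \<Rightarrow> real \<times> real \<times> real" where
  "graph_tangent g x y = (\<lambda>(u, v). (u * d1 g x y + v * d2 g x y, u, v))"

definition spacelike_at :: "(real \<Rightarrow> real \<Rightarrow> real) \<Rightarrow> real \<Rightarrow> real \<Rightarrow> bool" where
  "spacelike_at g x y \<longleftrightarrow>
     (\<forall>w. w \<noteq> (0, 0) \<longrightarrow> lorentz_metric (graph_tangent g x y w) (graph_tangent g x y w) > 0)"

lemma spacelike_at_iff: "spacelike_at g x y \<longleftrightarrow> 1 - (d1 g x y)\<^sup>2 - (d2 g x y)\<^sup>2 > 0"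
proof -
  define a where "a = d1 g x y"
  define b where "b = d2 g x y"
  have eq: "lorentz_metric (graph_tangent g x y (u, v)) (graph_tangent g x y (u, v))
      = u\<^sup>2 + v\<^sup>2 - (u * a + v * b)\<^sup>2" for u v
    by (simp add: lorentz_metric_def graph_tangent_def a_def b_def power2_eq_square)
  have cs: "(u * a + v * b)\<^sup>2 + (u * b - v * a)\<^sup>2 = (u\<^sup>2 + v\<^sup>2) * (a\<^sup>2 + b\<^sup>2)" for u v
    by (simp add: power2_eq_square algebra_simps)
  show ?thesis
    unfolding a_def[symmetric] b_def[symmetric]
  proof
    assume *: "spacelike_at g x y"
    show "1 - a\<^sup>2 - b\<^sup>2 > 0"
    proof (cases "a = 0 \<and> b = 0")
      case False
      then have pos: "a\<^sup>2 + b\<^sup>2 > 0"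
        by (simp add: sum_power2_gt_zero_iff)
      have "a\<^sup>2 + b\<^sup>2 - (a * a + b * b)\<^sup>2 > 0"
        using * False unfolding spacelike_at_def by (metis eq prod.inject)
      then have "(a\<^sup>2 + b\<^sup>2) * (1 - a\<^sup>2 - b\<^sup>2) > 0"
        by (simp add: power2_eq_square algebra_simps)
      with pos show ?thesis
        by (simp add: zero_less_mult_iff)
    qed auto
  next
    assume *: "1 - a\<^sup>2 - b\<^sup>2 > 0"
    have "u\<^sup>2 + v\<^sup>2 - (u * a + v * b)\<^sup>2 > 0" if "(u, v) \<noteq> (0, 0)" for u v
    proof -
      have pos: "u\<^sup>2 + v\<^sup>2 > 0"
        using that by (simp add: sum_power2_gt_zero_iff)
      have "(u * a + v * b)\<^sup>2 \<le> (u\<^sup>2 + v\<^sup>2) * (a\<^sup>2 + b\<^sup>2)"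
        using cs[of u v] zero_le_power2[of "u * b - v * a"] by linarith
      also have "\<dots> < (u\<^sup>2 + v\<^sup>2) * 1"
        using pos * by (intro mult_strict_left_mono) auto
      finally show ?thesis by simp
    qed
    then show "spacelike_at g x y"
      unfolding spacelike_at_def by (metis eq surj_pair)
  qed
qed

definition taylor_coeff :: "(real \<Rightarrow> real \<Rightarrow> real) \<Rightarrow> nat \<Rightarrow> nat \<Rightarrow> real" where
  "taylor_coeff f j k =
     (deriv ^^ j) (\<lambda>x. (deriv ^^ k) (\<lambda>y. f x y) 0) 0 / (fact j * fact k)"

definition taylor_term ::
    "(real \<Rightarrow> real \<Rightarrow> real) \<Rightarrow> complex \<Rightarrow> complex \<Rightarrow> nat \<times> nat \<Rightarrow> complex" where
  "taylor_term f z w = (\<lambda>(j, k). complex_of_real (taylor_coeff f j k) * z ^ j * w ^ k)"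

definition taylor_ext :: "(real \<Rightarrow> real \<Rightarrow> real) \<Rightarrow> complex \<Rightarrow> complex \<Rightarrow> complex" where
  "taylor_ext f z w = infsum (taylor_term f z w) UNIV"

text \<open>The open set of real \<open>(x, y)\<close> around which \<open>f(ix, iy)\<close> is given by the convergent Taylor
  expansion. Taking the interior discards points (for instance on the axes) at which the series
  may converge without doing so nearby.\<close>

definition wick_domain :: "(real \<Rightarrow> real \<Rightarrow> real) \<Rightarrow> (real \<times> real) set" where
  "wick_domain f = interior {(x, y).
     taylor_term f (\<i> * complex_of_real x) (\<i> * complex_of_real y) summable_on UNIV}"

definition axes_even_on :: "(real \<times> real) set \<Rightarrow> (real \<Rightarrow> real \<Rightarrow> real) \<Rightarrow> bool" where
  "axes_even_on D f \<longleftrightarrow> (\<forall>(x, y)\<in>D. f (- x) y = f x y \<and> f x (- y) = f x y)"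

definition axes_odd_on :: "(real \<times> real) set \<Rightarrow> (real \<Rightarrow> real \<Rightarrow> real) \<Rightarrow> bool" where
  "axes_odd_on D f \<longleftrightarrow> (\<forall>(x, y)\<in>D. f (- x) y = - f x y \<and> f x (- y) = - f x y)"

end

theory Submission
  imports Defs "HOL-Complex_Analysis.Complex_Analysis"
begin

text \<open>
  In the even and in the odd case alike, composing the two reflections gives the point symmetry
  \<open>f(-x, -y) = f(x, y)\<close>, so both cases run in parallel. The symmetry forces the Taylor coefficients
  \<open>a\<^sub>j\<^sub>k\<close> of \<open>f\<close> with \<open>j + k\<close> odd to vanish, so \<open>f(ix, iy)\<close> is the real series with coefficients \<open>b\<^sub>j\<^sub>k = (-1)\<^bsup>(j+k)/2\<^esup> a\<^sub>j\<^sub>k\<close>. The coefficients of \<open>b\<close> and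
  \<open>a\<close> have the same moduli, so both double series converge absolutely on the same set, whose interior
  \<open>U\<close> is the Wick domain. There \<open>g\<close> may be differentiated termwise as often as wanted
  (\<open>series_on_d1\<close>, \<open>series_on_d2\<close>), which makes it \<open>C\<^sup>2\<close>. The linear coefficients of \<open>g\<close> vanish
  because \<open>1 + 0\<close> is odd; so the gradient is zero at the origin, and by continuity the graph is
  spacelike nearby.

  For the sum of the series, the minimal surface equation is known only near the origin, while the
  zero mean curvature equation is wanted on all of \<open>U\<close>, which need not lie in the domain of \<open>f\<close>.
  Fix \<open>(x, y) \<in> U\<close> and replace \<open>(x, y)\<close> by \<open>(tx, ty)\<close> with a complex parameter \<open>t\<close>. Every partial
  derivative of the series of \<open>f\<close> becomes a holomorphic function of \<open>t\<close> on a disc of some radius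
  \<open>\<rho> > 1\<close>, since \<open>U\<close> is open (\<open>ray_ext_holomorphic\<close>). The left-hand side \<open>E(t)\<close> of the minimal
  surface equation is then holomorphic there as well. It vanishes for small real \<open>t\<close>, thus on the
  whole disc, and in particular at \<open>t = \<i>\<close>. Each differentiation contributes a factor \<open>-\<i>\<close> at \<open>t = \<i>\<close> (\<open>rotated_formal_d1\<close>,
  \<open>rotated_formal_d2\<close>), and this turns \<open>E(\<i>) = 0\<close> into the zero mean curvature equation for \<open>g\<close> at
  \<open>(x, y)\<close> (\<open>wick_rotation_zmc\<close>). An overall sign \<open>\<sigma> = \<plusminus>1\<close> in front of \<open>g\<close> is carried along, because
  the odd case asks for \<open>-f(ix, iy)\<close>.
\<close>

section \<open>Double power series and their domain of convergence\<close>

definition conv_set :: "(nat \<Rightarrow> nat \<Rightarrow> real) \<Rightarrow> (real \<times> real) set" where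
  "conv_set c = {(x, y). (\<lambda>(j, k). c j k * x ^ j * y ^ k) summable_on UNIV}"

definition dseries :: "(nat \<Rightarrow> nat \<Rightarrow> real) \<Rightarrow> real \<Rightarrow> real \<Rightarrow> real" where
  "dseries c x y = (\<Sum>\<^sub>\<infinity>(j, k). c j k * x ^ j * y ^ k)"

definition formal_d1 :: "(nat \<Rightarrow> nat \<Rightarrow> real) \<Rightarrow> nat \<Rightarrow> nat \<Rightarrow> real" where
  "formal_d1 c j k = real (Suc j) * c (Suc j) k"

definition formal_d2 :: "(nat \<Rightarrow> nat \<Rightarrow> real) \<Rightarrow> nat \<Rightarrow> nat \<Rightarrow> real" where
  "formal_d2 c j k = real (Suc k) * c j (Suc k)"

lemma conv_set_abs_iff:
  "(x, y) \<in> conv_set c \<longleftrightarrow> (\<lambda>(j, k). \<bar>c j k\<bar> * \<bar>x\<bar> ^ j * \<bar>y\<bar> ^ k) summable_on UNIV"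
proof -
  have "(x, y) \<in> conv_set c \<longleftrightarrow>
      (\<lambda>p. norm ((\<lambda>(j, k). c j k * x ^ j * y ^ k) p)) summable_on UNIV"
    unfolding conv_set_def mem_Collect_eq case_prod_conv
    by (rule summable_on_iff_abs_summable_on_real)
  also have "(\<lambda>p. norm ((\<lambda>(j, k). c j k * x ^ j * y ^ k) p)) =
      (\<lambda>(j, k). \<bar>c j k\<bar> * \<bar>x\<bar> ^ j * \<bar>y\<bar> ^ k)"
    by (simp add: fun_eq_iff abs_mult power_abs)
  finally show ?thesis .
qed

lemma conv_set_downward:
  assumes "(X, Y) \<in> conv_set c" "\<bar>x\<bar> \<le> \<bar>X\<bar>" "\<bar>y\<bar> \<le> \<bar>Y\<bar>"
  shows "(x, y) \<in> conv_set c"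
  unfolding conv_set_abs_iff
proof (rule summable_on_comparison_test)
  show "(\<lambda>(j, k). \<bar>c j k\<bar> * \<bar>X\<bar> ^ j * \<bar>Y\<bar> ^ k) summable_on UNIV"
    using assms(1) by (simp add: conv_set_abs_iff)
  show "(\<lambda>(j, k). \<bar>c j k\<bar> * \<bar>x\<bar> ^ j * \<bar>y\<bar> ^ k) p
      \<le> (\<lambda>(j, k). \<bar>c j k\<bar> * \<bar>X\<bar> ^ j * \<bar>Y\<bar> ^ k) p" for p
    unfolding case_prod_unfold
    by (intro mult_mono power_mono mult_nonneg_nonneg zero_le_power abs_ge_zero assms(2,3)) simp
qed (auto simp: case_prod_unfold)

text \<open>This reduces every question about interior points to a single dominating point: membership is
  monotone in \<open>\<bar>x\<bar>\<close> and \<open>\<bar>y\<bar>\<close>, so an interior point can be pushed away from both axes, and conversely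
  a whole open rectangle lies below any point of the set.\<close>

lemma interior_conv_set_iff:
  "(x, y) \<in> interior (conv_set c) \<longleftrightarrow> (\<exists>X Y. \<bar>x\<bar> < X \<and> \<bar>y\<bar> < Y \<and> (X, Y) \<in> conv_set c)"
proof
  assume "(x, y) \<in> interior (conv_set c)"
  then obtain e where e: "e > 0" "ball (x, y) e \<subseteq> conv_set c"
    by (auto simp: mem_interior)
  define d where "d = e / 4"
  \<comment> \<open>moves each coordinate away from zero by \<open>d\<close>\<close>
  define s where "s = (\<lambda>u::real. if u \<ge> 0 then u + d else u - d)"
  have s: "\<bar>s u\<bar> = \<bar>u\<bar> + d" "dist u (s u) = d" for u
    using e(1) by (auto simp: s_def d_def dist_real_def)
  have "dist (x, y) (s x, s y) \<le> dist x (s x) + dist y (s y)"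
    unfolding dist_Pair_Pair by (intro sqrt_sum_squares_le_sum zero_le_dist)
  also have "\<dots> < e"
    unfolding s(2) using e(1) by (simp add: d_def)
  finally have "(s x, s y) \<in> conv_set c"
    using e(2) by auto
  then have "(\<bar>s x\<bar>, \<bar>s y\<bar>) \<in> conv_set c"
    by (rule conv_set_downward) auto
  moreover have "\<bar>x\<bar> < \<bar>s x\<bar>" "\<bar>y\<bar> < \<bar>s y\<bar>"
    unfolding s(1) using e(1) by (simp_all add: d_def)
  ultimately show "\<exists>X Y. \<bar>x\<bar> < X \<and> \<bar>y\<bar> < Y \<and> (X, Y) \<in> conv_set c"
    by blast
next
  assume "\<exists>X Y. \<bar>x\<bar> < X \<and> \<bar>y\<bar> < Y \<and> (X, Y) \<in> conv_set c"
  then obtain X Y where XY: "\<bar>x\<bar> < X" "\<bar>y\<bar> < Y" "(X, Y) \<in> conv_set c"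
    by blast
  show "(x, y) \<in> interior (conv_set c)"
  proof (rule interiorI)
    show "open ({- X<..<X} \<times> {- Y<..<Y})"
      by (intro open_Times) auto
    show "{- X<..<X} \<times> {- Y<..<Y} \<subseteq> conv_set c"
    proof clarify
      fix u v
      assume "u \<in> {- X<..<X}" "v \<in> {- Y<..<Y}"
      then show "(u, v) \<in> conv_set c"
        by (intro conv_set_downward[OF XY(3)]) auto
    qed
    show "(x, y) \<in> {- X<..<X} \<times> {- Y<..<Y}"
      using XY by auto
  qed
qed

text \<open>Exchanging the two variables transposes the coefficients; this transfers everything proved for
  the first variable to the second.\<close>

lemma dseries_transpose: "dseries (\<lambda>j k. c k j) y x = dseries c x y"
  unfolding dseries_def
  by (rule infsum_reindex_bij_witness[where i = prod.swap and j = prod.swap]) (auto simp: mult_ac)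

lemma conv_set_transpose: "(y, x) \<in> conv_set (\<lambda>j k. c k j) \<longleftrightarrow> (x, y) \<in> conv_set c"
  unfolding conv_set_def mem_Collect_eq case_prod_conv
  by (rule summable_on_reindex_bij_witness[where i = prod.swap and j = prod.swap])
     (auto simp: mult_ac)

lemma interior_conv_set_transpose:
  "(y, x) \<in> interior (conv_set (\<lambda>j k. c k j)) \<longleftrightarrow> (x, y) \<in> interior (conv_set c)"
  unfolding interior_conv_set_iff conv_set_transpose[of _ _ c] by blast

lemma formal_d1_transpose: "formal_d1 (\<lambda>j k. c k j) = (\<lambda>j k. formal_d2 c k j)"
  by (simp add: formal_d1_def formal_d2_def fun_eq_iff)

text \<open>By Fubini, fixing \<open>y\<close> leaves an ordinary power series in \<open>x\<close>, to which the theory of power series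
  in one variable applies.\<close>

lemma dseries_iterated_sums:
  assumes "(x, y) \<in> conv_set c"
  shows "(\<lambda>j. (\<Sum>\<^sub>\<infinity>k. c j k * y ^ k) * x ^ j) sums dseries c x y"
proof -
  let ?t = "\<lambda>(j, k). c j k * x ^ j * y ^ k"
  have sm: "?t summable_on UNIV \<times> UNIV"
    using assms by (simp add: conv_set_def)
  have *: "(\<Sum>\<^sub>\<infinity>k. ?t (j, k)) = (\<Sum>\<^sub>\<infinity>k. c j k * y ^ k) * x ^ j" for j
    by (subst infsum_cmult_left'[symmetric]) (simp add: mult_ac)
  have "(\<lambda>j. \<Sum>\<^sub>\<infinity>k. ?t (j, k)) summable_on UNIV"
    using summable_on_Sigma_banach[of "\<lambda>j k. ?t (j, k)" UNIV "\<lambda>_. UNIV"] sm by simp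
  moreover have "(\<Sum>\<^sub>\<infinity>j. \<Sum>\<^sub>\<infinity>k. ?t (j, k)) = dseries c x y"
    using infsum_Sigma_banach[OF sm] by (simp add: dseries_def)
  ultimately have "((\<lambda>j. \<Sum>\<^sub>\<infinity>k. ?t (j, k)) has_sum dseries c x y) UNIV"
    by (simp add: has_sum_iff)
  then show ?thesis
    unfolding * by (rule has_sum_imp_sums)
qed

lemma linear_times_geometric_bounded:
  fixes q :: real
  assumes "\<bar>q\<bar> < 1"
  shows "\<exists>M. \<forall>n. real (Suc n) * \<bar>q\<bar> ^ n \<le> M"
proof -
  have "(\<lambda>n. real n * \<bar>q\<bar> ^ n + \<bar>q\<bar> ^ n) \<longlonglongrightarrow> 0 + 0"
    using assms by (intro tendsto_add powser_times_n_limit_0 LIMSEQ_power_zero) auto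
  then have "Bseq (\<lambda>n. real n * \<bar>q\<bar> ^ n + \<bar>q\<bar> ^ n)"
    by (intro convergent_imp_Bseq) (auto simp: convergent_def)
  then obtain M where "\<And>n. norm (real n * \<bar>q\<bar> ^ n + \<bar>q\<bar> ^ n) \<le> M"
    by (auto simp: Bseq_def)
  then show ?thesis
    by (intro exI[of _ M]) (simp add: algebra_simps abs_le_iff)
qed

text \<open>Shrinking \<open>X\<close> to \<open>x\<close> gains a geometric factor \<open>\<bar>x / X\<bar>\<^sup>j\<close>, which absorbs the factor \<open>j + 1\<close> that
  differentiation produces.\<close>

lemma conv_set_formal_d1:
  assumes "(X, Y) \<in> conv_set c" "\<bar>x\<bar> < X"
  shows "(x, Y) \<in> conv_set (formal_d1 c)"
proof -
  have X: "X > 0"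
    using assms(2) by linarith
  have "\<bar>x / X\<bar> < 1"
    using assms(2) X by simp
  then obtain M where M: "\<And>n. real (Suc n) * \<bar>x / X\<bar> ^ n \<le> M"
    using linear_times_geometric_bounded[of "x / X"] by auto
  let ?T = "\<lambda>(j, k). \<bar>c j k\<bar> * \<bar>X\<bar> ^ j * \<bar>Y\<bar> ^ k"
  have inj: "inj (map_prod Suc (id :: nat \<Rightarrow> nat))"
    by (intro prod.inj_map) auto
  have "?T summable_on UNIV"
    using assms(1) by (simp add: conv_set_abs_iff)
  then have "?T summable_on range (map_prod Suc id)"
    by (rule summable_on_subset_banach) simp
  then have "(\<lambda>p. (M / X) * (?T \<circ> map_prod Suc id) p) summable_on UNIV"
    unfolding summable_on_reindex[OF inj] by (rule summable_on_cmult_right)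
  then show ?thesis
    unfolding conv_set_abs_iff
  proof (rule summable_on_comparison_test)
    show "(\<lambda>(j, k). \<bar>formal_d1 c j k\<bar> * \<bar>x\<bar> ^ j * \<bar>Y\<bar> ^ k) p
        \<le> (M / X) * (?T \<circ> map_prod Suc id) p" for p
    proof (cases p)
      case (Pair j k)
      have "real (Suc j) * \<bar>x\<bar> ^ j = (real (Suc j) * \<bar>x / X\<bar> ^ j) * X ^ j"
        using X by (simp add: power_divide)
      also have "\<dots> \<le> M * X ^ j"
        using M X by (intro mult_right_mono) auto
      finally have "(real (Suc j) * \<bar>x\<bar> ^ j) * (\<bar>c (Suc j) k\<bar> * \<bar>Y\<bar> ^ k)
          \<le> (M * X ^ j) * (\<bar>c (Suc j) k\<bar> * \<bar>Y\<bar> ^ k)"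
        by (intro mult_right_mono) auto
      then show ?thesis
        using X by (simp add: Pair formal_d1_def abs_mult mult_ac del: of_nat_Suc)
    qed
    show "0 \<le> (\<lambda>(j, k). \<bar>formal_d1 c j k\<bar> * \<bar>x\<bar> ^ j * \<bar>Y\<bar> ^ k) p" for p
      by (cases p) simp
  qed
qed

lemma interior_conv_set_formal_d1:
  "interior (conv_set c) \<subseteq> interior (conv_set (formal_d1 c))"
proof clarify
  fix x y
  assume "(x, y) \<in> interior (conv_set c)"
  then obtain X Y where XY: "\<bar>x\<bar> < X" "\<bar>y\<bar> < Y" "(X, Y) \<in> conv_set c"
    by (auto simp: interior_conv_set_iff)
  obtain X' where "\<bar>x\<bar> < X'" "X' < X"
    using dense[OF XY(1)] by blast
  then show "(x, y) \<in> interior (conv_set (formal_d1 c))"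
    using XY(2) conv_set_formal_d1[OF XY(3), of X'] unfolding interior_conv_set_iff
    by (intro exI[of _ X'] exI[of _ Y]) simp
qed

lemma interior_conv_set_formal_d2:
  "interior (conv_set c) \<subseteq> interior (conv_set (formal_d2 c))"
proof clarify
  fix x y
  assume "(x, y) \<in> interior (conv_set c)"
  then have "(y, x) \<in> interior (conv_set (\<lambda>j k. c k j))"
    by (simp only: interior_conv_set_transpose[of y x c])
  then have "(y, x) \<in> interior (conv_set (\<lambda>j k. formal_d2 c k j))"
    using interior_conv_set_formal_d1[of "\<lambda>j k. c k j"] by (auto simp only: formal_d1_transpose[of c])
  then show "(x, y) \<in> interior (conv_set (formal_d2 c))"
    by (simp only: interior_conv_set_transpose[of y x "formal_d2 c"])
qed

lemma dseries_has_derivative_fst: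
  assumes "(x, y) \<in> interior (conv_set c)"
  shows "((\<lambda>u. dseries c u y) has_field_derivative dseries (formal_d1 c) x y) (at x)"
proof -
  obtain X Y where XY: "\<bar>x\<bar> < X" "\<bar>y\<bar> < Y" "(X, Y) \<in> conv_set c"
    using assms by (auto simp: interior_conv_set_iff)
  define A where "A j = (\<Sum>\<^sub>\<infinity>k. c j k * y ^ k)" for j
  have in_conv: "(u, y) \<in> conv_set c" if "\<bar>u\<bar> \<le> X" for u
    using XY that by (intro conv_set_downward[OF XY(3)]) auto
  have eq: "(\<lambda>j. A j * u ^ j) sums dseries c u y" if "\<bar>u\<bar> \<le> X" for u
    unfolding A_def by (rule dseries_iterated_sums[OF in_conv[OF that]])
  have "((\<lambda>u. \<Sum>j. A j * u ^ j) has_field_derivative (\<Sum>j. diffs A j * x ^ j)) (at x)"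
  proof (rule termdiffs_strong)
    show "summable (\<lambda>j. A j * X ^ j)"
      using eq[of X] XY by (auto simp: sums_iff)
  qed (use XY in auto)
  moreover have "diffs A j = (\<Sum>\<^sub>\<infinity>k. formal_d1 c j k * y ^ k)" for j
    unfolding diffs_def A_def formal_d1_def
    by (subst infsum_cmult_right'[symmetric]) (simp add: mult_ac)
  moreover have "(x, y) \<in> conv_set (formal_d1 c)"
    using interior_conv_set_formal_d1 interior_subset assms by blast
  ultimately have "((\<lambda>u. \<Sum>j. A j * u ^ j) has_field_derivative dseries (formal_d1 c) x y) (at x)"
    using dseries_iterated_sums[of x y "formal_d1 c"] by (simp add: sums_iff)
  then show ?thesis
  proof (rule has_field_derivative_transform_within_open)
    show "open {- X<..<X}" "x \<in> {- X<..<X}"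
      using XY by auto
    show "(\<Sum>j. A j * u ^ j) = dseries c u y" if "u \<in> {- X<..<X}" for u
    proof -
      have "\<bar>u\<bar> \<le> X"
        using that by auto
      then show ?thesis
        by (rule sums_unique[OF eq, symmetric])
    qed
  qed
qed

lemma dseries_has_derivative_snd:
  assumes "(x, y) \<in> interior (conv_set c)"
  shows "((\<lambda>v. dseries c x v) has_field_derivative dseries (formal_d2 c) x y) (at y)"
proof -
  have "(y, x) \<in> interior (conv_set (\<lambda>j k. c k j))"
    by (rule iffD2[OF interior_conv_set_transpose assms])
  from dseries_has_derivative_fst[OF this] show ?thesis
    unfolding formal_d1_transpose[of c] dseries_transpose[of c] dseries_transpose[of "formal_d2 c"] .
qed

text \<open>On the rectangle below a dominating point the terms have a summable bound independent of the
  point, so the partial sums converge uniformly there.\<close>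

lemma continuous_on_dseries: "continuous_on (interior (conv_set c)) (\<lambda>(x, y). dseries c x y)"
proof -
  have "continuous (at (x, y)) (\<lambda>(x, y). dseries c x y)"
    if xy: "(x, y) \<in> interior (conv_set c)" for x y
  proof -
    obtain X Y where XY: "\<bar>x\<bar> < X" "\<bar>y\<bar> < Y" "(X, Y) \<in> conv_set c"
      using xy by (auto simp: interior_conv_set_iff)
    define R where "R = {- X<..<X} \<times> {- Y<..<Y}"
    let ?t = "\<lambda>(j, k) (x, y). c j k * x ^ j * y ^ k"
    have "uniform_limit R (\<lambda>A p. \<Sum>i\<in>A. ?t i p) (\<lambda>p. \<Sum>\<^sub>\<infinity>i. ?t i p) (finite_subsets_at_top UNIV)"
    proof (rule Weierstrass_m_test_general)
      show "(\<lambda>(j, k). \<bar>c j k\<bar> * \<bar>X\<bar> ^ j * \<bar>Y\<bar> ^ k) summable_on UNIV"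
        using XY(3) by (simp add: conv_set_abs_iff)
      show "norm (?t i p) \<le> (\<lambda>(j, k). \<bar>c j k\<bar> * \<bar>X\<bar> ^ j * \<bar>Y\<bar> ^ k) i" if "p \<in> R" for i p
        using that
        by (auto simp: R_def case_prod_unfold abs_mult power_abs intro!: mult_mono power_mono)
    qed
    then have "continuous_on R (\<lambda>p. \<Sum>\<^sub>\<infinity>i. ?t i p)"
      by (rule uniform_limit_theorem[rotated])
         (auto simp: case_prod_unfold intro!: always_eventually continuous_intros)
    moreover have "(\<Sum>\<^sub>\<infinity>i. ?t i p) = (\<lambda>(x, y). dseries c x y) p" for p
      by (simp add: dseries_def case_prod_unfold)
    ultimately have "continuous_on R (\<lambda>(x, y). dseries c x y)"
      by simp
    moreover have "open R" "(x, y) \<in> R"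
      using XY by (auto simp: R_def intro!: open_Times)
    ultimately show ?thesis
      by (simp add: continuous_on_eq_continuous_at)
  qed
  then show ?thesis
    by (auto simp: continuous_on_eq_continuous_at)
qed

section \<open>Functions given by a double series on an open set\<close>

text \<open>The inclusion in the interior of the convergence set makes this notion stable under partial
  differentiation, so that it passes to derivatives of every order.\<close>

definition series_on ::
    "(real \<times> real) set \<Rightarrow> (real \<Rightarrow> real \<Rightarrow> real) \<Rightarrow> (nat \<Rightarrow> nat \<Rightarrow> real) \<Rightarrow> bool" where
  "series_on V h c \<longleftrightarrow>
     open V \<and> V \<subseteq> interior (conv_set c) \<and> (\<forall>(x, y)\<in>V. h x y = dseries c x y)"

lemma series_on_has_derivative:
  assumes "series_on V h c" "(x, y) \<in> V"
  shows "((\<lambda>u. h u y) has_field_derivative dseries (formal_d1 c) x y) (at x)"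
    and "((\<lambda>v. h x v) has_field_derivative dseries (formal_d2 c) x y) (at y)"
proof -
  have V: "open V" "(x, y) \<in> interior (conv_set c)" "\<And>u v. (u, v) \<in> V \<Longrightarrow> dseries c u v = h u v"
    using assms by (auto simp: series_on_def)
  obtain A B where AB: "open A" "open B" "(x, y) \<in> A \<times> B" "A \<times> B \<subseteq> V"
    by (rule open_prod_elim[OF V(1) assms(2)])
  show "((\<lambda>u. h u y) has_field_derivative dseries (formal_d1 c) x y) (at x)"
    by (rule has_field_derivative_transform_within_open
        [OF dseries_has_derivative_fst[OF V(2)] AB(1)]) (use AB V(3) in auto)
  show "((\<lambda>v. h x v) has_field_derivative dseries (formal_d2 c) x y) (at y)"
    by (rule has_field_derivative_transform_within_open
        [OF dseries_has_derivative_snd[OF V(2)] AB(2)]) (use AB V(3) in auto)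
qed

lemma series_on_d1: "series_on V h c \<Longrightarrow> series_on V (d1 h) (formal_d1 c)"
  using series_on_has_derivative(1)[of V h c] interior_conv_set_formal_d1[of c]
  by (force simp: series_on_def d1_def intro: DERIV_imp_deriv)

lemma series_on_d2: "series_on V h c \<Longrightarrow> series_on V (d2 h) (formal_d2 c)"
  using series_on_has_derivative(2)[of V h c] interior_conv_set_formal_d2[of c]
  by (force simp: series_on_def d2_def intro: DERIV_imp_deriv)

lemma series_on_continuous:
  assumes "series_on V h c"
  shows "continuous_on V (\<lambda>(x, y). h x y)"
proof -
  have "continuous_on V (\<lambda>(x, y). dseries c x y)"
    using assms continuous_on_dseries continuous_on_subset by (auto simp: series_on_def)
  then show ?thesis
    by (rule continuous_on_eq) (use assms in \<open>auto simp: series_on_def\<close>)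
qed

lemma series_on_C1: "series_on V h c \<Longrightarrow> C1_on V h"
  unfolding C1_on_def field_differentiable_def
  using series_on_has_derivative[of V h c] series_on_continuous[OF series_on_d1]
    series_on_continuous[OF series_on_d2] by fast

lemma series_on_C2: "series_on V h c \<Longrightarrow> C2_on V h"
  by (auto simp: C2_on_def intro: series_on_C1 series_on_d1 series_on_d2)

lemma dseries_origin: "dseries c 0 0 = c 0 0"
proof -
  have "dseries c 0 0 = (\<Sum>\<^sub>\<infinity>(j, k)\<in>{(0, 0)}. c j k * 0 ^ j * 0 ^ k)"
    unfolding dseries_def by (rule infsum_cong_neutral) auto
  then show ?thesis
    by simp
qed

section \<open>Taylor coefficients at the origin\<close>

lemma funpow_d1: "(d1 ^^ j) h x y = (deriv ^^ j) (\<lambda>u. h u y) x"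
proof (induction j arbitrary: x)
  case (Suc j)
  then have "(\<lambda>u. (d1 ^^ j) h u y) = (deriv ^^ j) (\<lambda>u. h u y)"
    by blast
  then show ?case
    by (simp only: funpow.simps o_apply d1_def[of "(d1 ^^ j) h"])
qed simp

lemma funpow_d2: "(d2 ^^ k) h x y = (deriv ^^ k) (\<lambda>v. h x v) y"
proof (induction k arbitrary: y)
  case (Suc k)
  then have "(\<lambda>v. (d2 ^^ k) h x v) = (deriv ^^ k) (\<lambda>v. h x v)"
    by blast
  then show ?case
    by (simp only: funpow.simps o_apply d2_def[of "(d2 ^^ k) h"])
qed simp

text \<open>Multiplying by \<open>fact j\<close> avoids writing the falling factorial that repeated formal
  differentiation produces.\<close>

lemma funpow_formal_d1: "(formal_d1 ^^ n) c j k * fact j = fact (j + n) * c (j + n) k"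
proof (induction n arbitrary: j)
  case (Suc n)
  have "(formal_d1 ^^ Suc n) c j k * fact j = (formal_d1 ^^ n) c (Suc j) k * fact (Suc j)"
    by (simp add: formal_d1_def algebra_simps)
  then show ?case
    by (simp only: Suc.IH) simp
qed simp

lemma funpow_formal_d2: "(formal_d2 ^^ n) c j k * fact k = fact (k + n) * c j (k + n)"
proof (induction n arbitrary: k)
  case (Suc n)
  have "(formal_d2 ^^ Suc n) c j k * fact k = (formal_d2 ^^ n) c j (Suc k) * fact (Suc k)"
    by (simp add: formal_d2_def algebra_simps)
  then show ?case
    by (simp only: Suc.IH) simp
qed simp

text \<open>Differentiating termwise \<open>k\<close> times in \<open>y\<close> and \<open>j\<close> times in \<open>x\<close> leaves a series whose constant
  coefficient is \<open>fact j * fact k * a j k\<close>, and a series takes the value of its constant coefficient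
  at the origin.\<close>

lemma taylor_coeff_unique:
  assumes "series_on V f a" "(0, 0) \<in> V"
  shows "taylor_coeff f = a"
proof (intro ext)
  fix j k
  have "series_on V ((d2 ^^ k) f) ((formal_d2 ^^ k) a)"
    by (induction k) (auto intro: series_on_d2 assms)
  then have "series_on V ((d1 ^^ j) ((d2 ^^ k) f)) ((formal_d1 ^^ j) ((formal_d2 ^^ k) a))"
    by (induction j) (auto intro: series_on_d1)
  then have "(d1 ^^ j) ((d2 ^^ k) f) 0 0 = (formal_d1 ^^ j) ((formal_d2 ^^ k) a) 0 0"
    using assms(2) by (auto simp: series_on_def dseries_origin)
  also have "\<dots> = fact j * (fact k * a j k)"
    using funpow_formal_d1[of j "(formal_d2 ^^ k) a" 0 0] funpow_formal_d2[of k a j 0] by simp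
  finally show "taylor_coeff f j k = a j k"
    by (simp add: taylor_coeff_def funpow_d1 funpow_d2)
qed

lemma series_on_square:
  assumes "\<And>x y. \<bar>x\<bar> < r \<Longrightarrow> \<bar>y\<bar> < r \<Longrightarrow>
      ((\<lambda>(j, k). c j k * x ^ j * y ^ k) has_sum f x y) UNIV"
  shows "series_on ({- r<..<r} \<times> {- r<..<r}) f c"
proof -
  let ?V = "{- r<..<r} \<times> {- r<..<r}"
  have "open ?V"
    by (intro open_Times) auto
  moreover have hs: "((\<lambda>(j, k). c j k * x ^ j * y ^ k) has_sum f x y) UNIV" if "(x, y) \<in> ?V" for x y
    using that by (intro assms) auto
  then have "?V \<subseteq> conv_set c"
    by (auto simp only: conv_set_def mem_Collect_eq case_prod_conv summable_on_def)
  ultimately have "?V \<subseteq> interior (conv_set c)"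
    by (intro interior_maximal)
  moreover have "f x y = dseries c x y" if "(x, y) \<in> ?V" for x y
    unfolding dseries_def by (rule infsumI[OF hs[OF that], symmetric])
  ultimately show ?thesis
    using \<open>open ?V\<close> unfolding series_on_def by fast
qed

text \<open>Replacing \<open>(x, y)\<close> by \<open>(-x, -y)\<close> multiplies \<open>a\<^sub>j\<^sub>k\<close> by \<open>(-1)\<^bsup>j+k\<^esup>\<close>. Since \<open>f\<close> is invariant, both
  families are Taylor coefficients of \<open>f\<close>, and uniqueness kills those of odd total degree.\<close>

lemma analytic_origin_series:
  assumes "open D" "(0, 0) \<in> D" "real_analytic_on D f"
    and sym: "\<forall>(x, y)\<in>D. f (- x) (- y) = f x y"
  obtains V where "V \<subseteq> D" "(0, 0) \<in> V" "series_on V f (taylor_coeff f)"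
    "\<forall>j k. odd (j + k) \<longrightarrow> taylor_coeff f j k = 0"
proof -
  obtain a r where r: "r > 0" and a: "\<And>x y. \<bar>x\<bar> < r \<Longrightarrow> \<bar>y\<bar> < r \<Longrightarrow>
      ((\<lambda>(j, k). a j k * x ^ j * y ^ k) has_sum f x y) UNIV"
    using assms(2,3) unfolding real_analytic_on_def by fastforce
  obtain e where e: "e > 0" "ball (0, 0) e \<subseteq> D"
    using assms(1,2) openE by blast
  \<comment> \<open>the factor \<open>1/2\<close> makes the square of half-width \<open>q\<close> fit into the disc of radius \<open>e\<close>\<close>
  define q where "q = min r (e / 2)"
  have q: "q > 0" "q \<le> r"
    using r e by (auto simp: q_def)
  define V where "V = {- q<..<q} \<times> {- q<..<q}"
  have VD: "V \<subseteq> D"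
  proof
    fix p assume "p \<in> V"
    then obtain x y where p: "p = (x, y)" "\<bar>x\<bar> < q" "\<bar>y\<bar> < q"
      by (auto simp: V_def)
    have "dist (0, 0) p \<le> \<bar>x\<bar> + \<bar>y\<bar>"
      by (simp add: p dist_Pair_Pair sqrt_sum_squares_le_sum_abs)
    also have "\<dots> < e"
      using p by (simp add: q_def)
    finally show "p \<in> D"
      using e by auto
  qed
  have V0: "(0, 0) \<in> V"
    using q by (simp add: V_def)
  have sa: "series_on V f a"
    unfolding V_def by (rule series_on_square) (use a q in auto)
  have ta: "taylor_coeff f = a"
    by (rule taylor_coeff_unique[OF sa V0])
  have coeff0: "taylor_coeff f j k = 0"
    if "odd (j + k)" for j k
  proof -
    define a' where "a' = (\<lambda>j k. (- 1) ^ (j + k) * a j k)"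
    have "series_on V f a'"
      unfolding V_def
    proof (rule series_on_square)
      fix x y :: real assume xy: "\<bar>x\<bar> < q" "\<bar>y\<bar> < q"
      have "((\<lambda>(j, k). a j k * (- x) ^ j * (- y) ^ k) has_sum f (- x) (- y)) UNIV"
        by (rule a) (use xy q in auto)
      moreover have "(x, y) \<in> D"
        using VD xy by (auto simp: V_def abs_less_iff)
      moreover have "a j k * (- x) ^ j * (- y) ^ k = a' j k * x ^ j * y ^ k" for j k
        by (simp add: a'_def power_minus[of x] power_minus[of y] power_add mult_ac)
      ultimately show "((\<lambda>(j, k). a' j k * x ^ j * y ^ k) has_sum f x y) UNIV"
        using sym by auto
    qed
    then have "taylor_coeff f = a'"
      by (rule taylor_coeff_unique[OF _ V0])
    then have "a j k = a' j k"
      using ta by simp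
    then show ?thesis
      using that ta by (simp add: a'_def)
  qed
  have "series_on V f (taylor_coeff f)"
    using sa ta by simp
  then show ?thesis
    using coeff0 by (intro that[OF VD V0]) simp_all
qed

section \<open>Continuation along complex multiples of a real point\<close>

text \<open>The sum of the double series at \<open>(tx, ty)\<close> for complex \<open>t\<close>. Only this one complex variable is
  needed to pass from real to imaginary arguments.\<close>

definition ray_ext :: "(nat \<Rightarrow> nat \<Rightarrow> real) \<Rightarrow> real \<Rightarrow> real \<Rightarrow> complex \<Rightarrow> complex" where
  "ray_ext c x y t = (\<Sum>\<^sub>\<infinity>(j, k). complex_of_real (c j k * x ^ j * y ^ k) * t ^ (j + k))"

text \<open>A divergent series has the default sum \<open>0\<close> on both sides.\<close>

lemma infsum_of_real:
  "(\<Sum>\<^sub>\<infinity>p\<in>A. complex_of_real (h p)) = of_real (infsum h A)"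
proof (cases "h summable_on A")
  case True
  then show ?thesis
    by (intro infsumI has_sum_of_real has_sum_infsum)
next
  case False
  then have "\<not> (\<lambda>p. complex_of_real (h p)) summable_on A"
    using summable_on_Re[of "\<lambda>p. complex_of_real (h p)" A] by auto
  then show ?thesis
    using False by (simp add: infsum_not_exists)
qed

lemma ray_ext_of_real: "ray_ext c x y (of_real t) = of_real (dseries c (t * x) (t * y))"
  unfolding ray_ext_def dseries_def infsum_of_real[symmetric]
  by (rule infsum_cong) (auto simp: power_add power_mult_distrib)

text \<open>For \<open>\<bar>t\<bar> \<le> \<rho>\<close> the terms are dominated by those at \<open>(\<rho>x, \<rho>y)\<close>, so the polynomial partial sums
  converge uniformly on the closed disc.\<close>

lemma ray_ext_holomorphic:
  assumes "(\<rho> * x, \<rho> * y) \<in> conv_set c"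
  shows "ray_ext c x y holomorphic_on ball 0 \<rho>"
proof -
  let ?t = "\<lambda>(j, k) t. complex_of_real (c j k * x ^ j * y ^ k) * t ^ (j + k)"
  have lim: "uniform_limit (cball 0 \<rho>) (\<lambda>A t. \<Sum>i\<in>A. ?t i t) (\<lambda>t. \<Sum>\<^sub>\<infinity>i. ?t i t)
      (finite_subsets_at_top UNIV)"
  proof (rule Weierstrass_m_test_general)
    show "(\<lambda>(j, k). \<bar>c j k\<bar> * \<bar>\<rho> * x\<bar> ^ j * \<bar>\<rho> * y\<bar> ^ k) summable_on UNIV"
      using assms by (simp add: conv_set_abs_iff)
    fix i :: "nat \<times> nat" and t :: complex
    assume "t \<in> cball 0 \<rho>"
    then have t: "norm t \<le> \<bar>\<rho>\<bar>"
      by simp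
    obtain j k where i: "i = (j, k)"
      by (cases i)
    have "norm (?t i t) = (\<bar>c j k\<bar> * \<bar>x\<bar> ^ j * \<bar>y\<bar> ^ k) * norm t ^ (j + k)"
      by (simp add: i norm_mult norm_power abs_mult power_abs)
    also have "\<dots> \<le> (\<bar>c j k\<bar> * \<bar>x\<bar> ^ j * \<bar>y\<bar> ^ k) * \<bar>\<rho>\<bar> ^ (j + k)"
      using t by (intro mult_left_mono power_mono) simp_all
    also have "\<dots> = (\<lambda>(j, k). \<bar>c j k\<bar> * \<bar>\<rho> * x\<bar> ^ j * \<bar>\<rho> * y\<bar> ^ k) i"
      by (simp add: i abs_mult power_mult_distrib power_add)
    finally show "norm (?t i t) \<le> (\<lambda>(j, k). \<bar>c j k\<bar> * \<bar>\<rho> * x\<bar> ^ j * \<bar>\<rho> * y\<bar> ^ k) i" .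
  qed
  have partial: "(\<lambda>t. \<Sum>i\<in>A. ?t i t) holomorphic_on S" for A S
    unfolding case_prod_unfold by (intro holomorphic_intros)
  have "(\<lambda>t. \<Sum>\<^sub>\<infinity>i. ?t i t) holomorphic_on ball 0 \<rho>"
  proof (rule holomorphic_uniform_limit[OF _ lim])
    show "\<forall>\<^sub>F A in finite_subsets_at_top UNIV.
        continuous_on (cball 0 \<rho>) (\<lambda>t. \<Sum>i\<in>A. ?t i t) \<and>
        (\<lambda>t. \<Sum>i\<in>A. ?t i t) holomorphic_on ball 0 \<rho>"
      by (intro always_eventually allI conjI partial holomorphic_on_imp_continuous_on)
  qed (simp_all only: finite_subsets_at_top_neq_bot not_False_eq_True)
  then show ?thesis
    by (simp only: ray_ext_def[abs_def] case_prod_unfold)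
qed

text \<open>The series of \<open>a\<close> at \<open>(\<i>x, \<i>y)\<close> is \<open>w\<close> times the series of \<open>b\<close> at \<open>(x, y)\<close>, expressed termwise.
  The factor \<open>w\<close> keeps track of the powers of \<open>\<i>\<close> picked up by differentiation.\<close>

definition rotated :: "complex \<Rightarrow> (nat \<Rightarrow> nat \<Rightarrow> real) \<Rightarrow> (nat \<Rightarrow> nat \<Rightarrow> real) \<Rightarrow> bool" where
  "rotated w a b \<longleftrightarrow> (\<forall>j k. complex_of_real (a j k) * \<i> ^ (j + k) = w * complex_of_real (b j k))"

text \<open>The chain rule for \<open>g(x, y) = f(\<i>x, \<i>y) / w\<close> at the level of coefficients: a derivative lowers
  the total degree by one, which leaves a factor \<open>1 / \<i> = -\<i>\<close>.\<close>

lemma rotated_formal_d1: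
  assumes "rotated w a b"
  shows "rotated (- \<i> * w) (formal_d1 a) (formal_d1 b)"
  unfolding rotated_def
proof (intro allI)
  fix j k
  have "complex_of_real (formal_d1 a j k) * \<i> ^ (j + k)
      = - \<i> * of_nat (Suc j) * (complex_of_real (a (Suc j) k) * \<i> ^ (Suc j + k))"
    by (simp add: formal_d1_def mult_ac)
  also have "complex_of_real (a (Suc j) k) * \<i> ^ (Suc j + k) = w * complex_of_real (b (Suc j) k)"
    using assms unfolding rotated_def by blast
  finally show "complex_of_real (formal_d1 a j k) * \<i> ^ (j + k)
      = - \<i> * w * complex_of_real (formal_d1 b j k)"
    by (simp add: formal_d1_def)
qed

lemma rotated_formal_d2:
  assumes "rotated w a b"
  shows "rotated (- \<i> * w) (formal_d2 a) (formal_d2 b)"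
  unfolding rotated_def
proof (intro allI)
  fix j k
  have "complex_of_real (formal_d2 a j k) * \<i> ^ (j + k)
      = - \<i> * of_nat (Suc k) * (complex_of_real (a j (Suc k)) * \<i> ^ (j + Suc k))"
    by (simp add: formal_d2_def mult_ac)
  also have "complex_of_real (a j (Suc k)) * \<i> ^ (j + Suc k) = w * complex_of_real (b j (Suc k))"
    using assms unfolding rotated_def by blast
  finally show "complex_of_real (formal_d2 a j k) * \<i> ^ (j + k)
      = - \<i> * w * complex_of_real (formal_d2 b j k)"
    by (simp add: formal_d2_def)
qed

lemma ray_ext_imaginary_unit:
  assumes "rotated w a b"
  shows "ray_ext a x y \<i> = w * of_real (dseries b x y)"
proof -
  have "complex_of_real (a j k * x ^ j * y ^ k) * \<i> ^ (j + k)
      = w * of_real (b j k * x ^ j * y ^ k)" for j k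
  proof -
    have "complex_of_real (a j k * x ^ j * y ^ k) * \<i> ^ (j + k)
        = (complex_of_real (a j k) * \<i> ^ (j + k)) * of_real (x ^ j * y ^ k)"
      by simp
    also have "complex_of_real (a j k) * \<i> ^ (j + k) = w * of_real (b j k)"
      using assms unfolding rotated_def by blast
    finally show ?thesis
      by simp
  qed
  then have "ray_ext a x y \<i> = (\<Sum>\<^sub>\<infinity>p. w * of_real ((\<lambda>(j, k). b j k * x ^ j * y ^ k) p))"
    unfolding ray_ext_def by (intro infsum_cong) (simp add: case_prod_unfold)
  then show ?thesis
    by (simp only: infsum_cmult_right' infsum_of_real dseries_def)
qed

text \<open>The factor beyond \<open>1\<close> is what puts \<open>t = \<i>\<close> inside the disc of holomorphy of the ray
  extension, and not merely on its boundary.\<close>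

lemma conv_set_enlarge:
  assumes "(x, y) \<in> interior (conv_set c)"
  obtains \<rho> where "\<rho> > 1" "(\<rho> * x, \<rho> * y) \<in> interior (conv_set c)"
proof -
  have "((\<lambda>\<rho>. (\<rho> * x, \<rho> * y)) \<longlongrightarrow> (1 * x, 1 * y)) (at_right (1 :: real))"
    by (intro tendsto_intros)
  then have "eventually (\<lambda>\<rho>. (\<rho> * x, \<rho> * y) \<in> interior (conv_set c)) (at_right 1)"
    using assms by (intro topological_tendstoD) auto
  moreover have "eventually (\<lambda>\<rho>. \<rho> > 1) (at_right (1 :: real))"
    by (rule eventually_at_right_less)
  ultimately have "eventually (\<lambda>\<rho>. \<rho> > 1 \<and> (\<rho> * x, \<rho> * y) \<in> interior (conv_set c)) (at_right 1)"
    by (rule eventually_conj[rotated])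
  then show ?thesis
    using that eventually_happens trivial_limit_at_right_real by blast
qed

section \<open>The rotated equation\<close>

text \<open>The identity theorem carries the minimal surface equation from small real multiples of \<open>(x, y)\<close>
  to the multiple \<open>\<i>\<close>. First derivatives there are \<open>-\<i>s\<close> times those of the rotated series and second
  derivatives are \<open>-s\<close> times them. With \<open>s\<^sup>2 = 1\<close>, squares and products of two first derivatives
  change sign, which is exactly the difference between the two equations.\<close>

lemma wick_rotation_zmc:
  assumes ser: "series_on V f a" and V0: "(0, 0) \<in> V"
    and mse: "\<forall>(x, y)\<in>V. minimal_surface_eq f x y"
    and xy: "(x, y) \<in> interior (conv_set a)"
    and rot: "rotated s a b" and s: "s\<^sup>2 = 1"
  shows "(1 - (dseries (formal_d2 b) x y)\<^sup>2) * dseries (formal_d1 (formal_d1 b)) x y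
      + 2 * dseries (formal_d1 b) x y * dseries (formal_d2 b) x y * dseries (formal_d2 (formal_d1 b)) x y
      + (1 - (dseries (formal_d1 b) x y)\<^sup>2) * dseries (formal_d2 (formal_d2 b)) x y = 0"
proof -
  obtain \<rho> where \<rho>: "\<rho> > 1" "(\<rho> * x, \<rho> * y) \<in> interior (conv_set a)"
    using conv_set_enlarge[OF xy] .
  define H where "H c = ray_ext c x y" for c
  have hol: "H c holomorphic_on ball 0 \<rho>"
    if "interior (conv_set a) \<subseteq> interior (conv_set c)" for c
    unfolding H_def using that \<rho>(2) interior_subset by (intro ray_ext_holomorphic) blast
  note sub = interior_conv_set_formal_d1 interior_conv_set_formal_d2
  define E where "E t = (1 + (H (formal_d2 a) t)\<^sup>2) * H (formal_d1 (formal_d1 a)) t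
      - 2 * H (formal_d1 a) t * H (formal_d2 a) t * H (formal_d2 (formal_d1 a)) t
      + (1 + (H (formal_d1 a) t)\<^sup>2) * H (formal_d2 (formal_d2 a)) t" for t
  have holE: "E holomorphic_on ball 0 \<rho>"
    unfolding E_def
    by (intro holomorphic_intros hol sub sub[THEN order_trans[rotated]])
  \<comment> \<open>the real parameters for which the equation is known\<close>
  define Z where "Z = complex_of_real ` {t. \<bar>t\<bar> < \<rho> \<and> (t * x, t * y) \<in> V}"
  have E0: "E z = 0" if "z \<in> Z" for z
  proof -
    obtain t where t: "z = of_real t" "(t * x, t * y) \<in> V"
      using \<open>z \<in> Z\<close> by (auto simp: Z_def)
    note ser1 = series_on_d1[OF ser] and ser2 = series_on_d2[OF ser]
    have val: "H c z = of_real (h (t * x) (t * y))" if "series_on V h c" for h c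
      using that t by (auto simp: H_def ray_ext_of_real series_on_def)
    have "minimal_surface_eq f (t * x) (t * y)"
      using mse t(2) by blast
    moreover have "E z = of_real ((1 + (d2 f (t * x) (t * y))\<^sup>2) * d1 (d1 f) (t * x) (t * y)
        - 2 * d1 f (t * x) (t * y) * d2 f (t * x) (t * y) * d2 (d1 f) (t * x) (t * y)
        + (1 + (d1 f (t * x) (t * y))\<^sup>2) * d2 (d2 f) (t * x) (t * y))"
      unfolding E_def val[OF ser1] val[OF ser2] val[OF series_on_d1[OF ser1]]
        val[OF series_on_d2[OF ser1]] val[OF series_on_d2[OF ser2]]
      by simp
    ultimately show ?thesis
      unfolding minimal_surface_eq_def by simp
  qed
  have "0 islimpt Z"
    unfolding islimpt_approachable
  proof (intro allI impI)
    fix e :: real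
    assume "e > 0"
    have "((\<lambda>t. (t * x, t * y)) \<longlongrightarrow> (0 * x, 0 * y)) (at_right (0 :: real))"
      by (intro tendsto_intros)
    then have "eventually (\<lambda>t. (t * x, t * y) \<in> V) (at_right 0)"
      using ser V0 by (intro topological_tendstoD) (auto simp: series_on_def)
    moreover have "eventually (\<lambda>t. t \<in> {0<..<min e \<rho>}) (at_right (0 :: real))"
      using \<open>e > 0\<close> \<rho>(1) by (intro eventually_at_right_real) auto
    ultimately have "eventually (\<lambda>t. (t * x, t * y) \<in> V \<and> t \<in> {0<..<min e \<rho>}) (at_right 0)"
      by (rule eventually_conj)
    then obtain t where "(t * x, t * y) \<in> V" "0 < t" "t < e" "t < \<rho>"
      using eventually_happens trivial_limit_at_right_real by fastforce
    then show "\<exists>z\<in>Z. z \<noteq> 0 \<and> dist z 0 < e"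
      unfolding Z_def by (intro bexI[of _ "of_real t"] imageI) auto
  qed
  then have "E \<i> = 0"
    using \<rho>(1) E0
    by (intro analytic_continuation[OF holE, of Z 0 \<i>]) (auto simp: Z_def)
  moreover note rot1 = rotated_formal_d1[OF rot] and rot2 = rotated_formal_d2[OF rot]
  define p q r m n where "p = dseries (formal_d1 b) x y" and "q = dseries (formal_d2 b) x y"
    and "r = dseries (formal_d1 (formal_d1 b)) x y" and "m = dseries (formal_d2 (formal_d1 b)) x y"
    and "n = dseries (formal_d2 (formal_d2 b)) x y"
  have val: "H (formal_d1 a) \<i> = - \<i> * s * of_real p" "H (formal_d2 a) \<i> = - \<i> * s * of_real q"
    "H (formal_d1 (formal_d1 a)) \<i> = - s * of_real r" "H (formal_d2 (formal_d1 a)) \<i> = - s * of_real m"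
    "H (formal_d2 (formal_d2 a)) \<i> = - s * of_real n"
    unfolding H_def p_def q_def r_def m_def n_def
    using ray_ext_imaginary_unit[OF rot1] ray_ext_imaginary_unit[OF rot2]
      ray_ext_imaginary_unit[OF rotated_formal_d1[OF rot1]]
      ray_ext_imaginary_unit[OF rotated_formal_d2[OF rot1]]
      ray_ext_imaginary_unit[OF rotated_formal_d2[OF rot2]]
    by simp_all
  moreover have "E \<i> = - s * of_real ((1 - q\<^sup>2) * r + 2 * p * q * m + (1 - p\<^sup>2) * n)"
    using s unfolding E_def val by (simp add: power_mult_distrib) (simp add: algebra_simps power2_eq_square)
  moreover have "s \<noteq> 0"
    using s by auto
  ultimately have "complex_of_real ((1 - q\<^sup>2) * r + 2 * p * q * m + (1 - p\<^sup>2) * n) = 0"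
    by (metis mult_eq_0_iff neg_equal_0_iff_equal)
  then show ?thesis
    unfolding p_def q_def r_def m_def n_def of_real_eq_0_iff .
qed

section \<open>The Wick rotation\<close>

text \<open>Multiplying the arguments by \<open>\<i>\<close> leaves the moduli of the terms unchanged, and unconditional
  convergence of complex numbers is absolute.\<close>

lemma wick_domain_eq: "wick_domain f = interior (conv_set (taylor_coeff f))"
proof -
  have "taylor_term f (\<i> * complex_of_real x) (\<i> * complex_of_real y) summable_on UNIV \<longleftrightarrow>
      (x, y) \<in> conv_set (taylor_coeff f)" for x y
  proof -
    have "(\<lambda>p. norm (taylor_term f (\<i> * complex_of_real x) (\<i> * complex_of_real y) p)) =
        (\<lambda>(j, k). \<bar>taylor_coeff f j k\<bar> * \<bar>x\<bar> ^ j * \<bar>y\<bar> ^ k)"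
      by (simp add: fun_eq_iff taylor_term_def norm_mult norm_power)
    then show ?thesis
      unfolding conv_set_abs_iff by (subst summable_on_iff_abs_summable_on_complex) simp
  qed
  then show ?thesis
    unfolding wick_domain_def by (intro arg_cong[of _ _ interior]) auto
qed

lemma taylor_ext_imaginary_eq:
  "taylor_ext f (\<i> * complex_of_real x) (\<i> * complex_of_real y) = ray_ext (taylor_coeff f) x y \<i>"
  unfolding taylor_ext_def taylor_term_def ray_ext_def
  by (rule infsum_cong) (auto simp: power_mult_distrib power_add)

lemma spacelike_near_critical_point:
  assumes ser: "series_on V g b" and V0: "(0, 0) \<in> V" and b: "b (Suc 0) 0 = 0" "b 0 (Suc 0) = 0"
  shows "\<forall>\<^sub>F (x, y) in nhds (0, 0). spacelike_at g x y"
proof -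
  let ?G = "\<lambda>p. 1 - (case p of (x, y) \<Rightarrow> d1 g x y)\<^sup>2 - (case p of (x, y) \<Rightarrow> d2 g x y)\<^sup>2"
  note ser1 = series_on_d1[OF ser] and ser2 = series_on_d2[OF ser]
  have "open V"
    using ser by (simp add: series_on_def)
  moreover have "continuous_on V ?G"
    by (intro continuous_intros series_on_continuous[OF ser1] series_on_continuous[OF ser2])
  ultimately have "isCont ?G (0, 0)"
    using V0 by (simp only: continuous_on_eq_continuous_at)
  then have "(?G \<longlongrightarrow> ?G (0, 0)) (nhds (0, 0))"
    unfolding isCont_def by (rule tendsto_at_iff_tendsto_nhds[of ?G, THEN iffD1])
  moreover have "d1 g 0 0 = 0" "d2 g 0 0 = 0"
    using ser1 ser2 V0 b by (auto simp: series_on_def dseries_origin formal_d1_def formal_d2_def)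
  ultimately have "eventually (\<lambda>p. ?G p > 0) (nhds (0, 0))"
    by (intro order_tendstoD) auto
  then show ?thesis
    by (rule eventually_mono) (simp add: case_prod_unfold spacelike_at_iff)
qed

text \<open>The even and odd cases share the point symmetry and differ only in the sign \<open>\<sigma>\<close>; with
  \<open>\<sigma>\<^sup>2 = 1\<close> the coefficients \<open>b = \<sigma> \<i>\<^bsup>j+k\<^esup> a\<close> satisfy \<open>a \<i>\<^bsup>j+k\<^esup> = \<sigma> b\<close>.\<close>

lemma wick_rotation_solution:
  assumes D: "open D" "(0, 0) \<in> D" and analytic: "real_analytic_on D f"
    and mse: "\<forall>(x, y)\<in>D. minimal_surface_eq f x y"
    and sym: "\<forall>(x, y)\<in>D. f (- x) (- y) = f x y"
    and \<sigma>: "\<sigma>\<^sup>2 = (1 :: real)"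
  shows "(0, 0) \<in> wick_domain f \<and>
    (\<exists>g. (\<forall>(x, y)\<in>wick_domain f. complex_of_real (g x y) =
            of_real \<sigma> * taylor_ext f (\<i> * complex_of_real x) (\<i> * complex_of_real y)) \<and>
         zmc_solution_on (wick_domain f) g \<and>
         (\<forall>\<^sub>F (x, y) in nhds (0, 0). spacelike_at g x y))"
proof -
  define a where "a = taylor_coeff f"
  define U where "U = wick_domain f"
  have U: "U = interior (conv_set a)"
    by (simp add: U_def a_def wick_domain_eq)
  obtain V where V: "V \<subseteq> D" "(0, 0) \<in> V" "series_on V f a"
    and coeff0: "\<forall>j k. odd (j + k) \<longrightarrow> a j k = 0"
    unfolding a_def by (rule analytic_origin_series[OF D analytic sym])
  have U0: "(0, 0) \<in> U"
    using V(2,3) by (auto simp: U series_on_def)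
  define b where "b = (\<lambda>j k. \<sigma> * (- 1) ^ ((j + k) div 2) * a j k)"
  have abs_\<sigma>: "\<bar>\<sigma>\<bar> = 1"
    using \<sigma> by (auto simp: power2_eq_1_iff)
  have "conv_set b = conv_set a"
    by (auto simp: conv_set_abs_iff b_def abs_mult power_abs abs_\<sigma>)
  then have ser: "series_on U (dseries b) b"
    by (simp add: series_on_def U)
  have rot: "rotated (of_real \<sigma>) a b"
    unfolding rotated_def
  proof (intro allI)
    fix j k
    have "complex_of_real \<sigma> * of_real \<sigma> = 1"
      using \<sigma> by (simp add: power2_eq_square flip: of_real_mult)
    moreover have "\<i> ^ (j + k) = (- 1) ^ ((j + k) div 2)" if "even (j + k)"
      using that by (auto elim!: evenE simp: power_mult)
    ultimately show "complex_of_real (a j k) * \<i> ^ (j + k) = of_real \<sigma> * of_real (b j k)"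
      using coeff0 by (cases "even (j + k)") (simp_all add: b_def mult_ac)
  qed
  have "complex_of_real (dseries b x y) =
      of_real \<sigma> * taylor_ext f (\<i> * complex_of_real x) (\<i> * complex_of_real y)" for x y
    using \<sigma> unfolding taylor_ext_imaginary_eq a_def[symmetric] ray_ext_imaginary_unit[OF rot]
    by (simp add: power2_eq_square flip: of_real_mult mult.assoc)
  moreover have "zero_mean_curvature_eq (dseries b) x y" if xy: "(x, y) \<in> U" for x y
  proof -
    note ser1 = series_on_d1[OF ser] and ser2 = series_on_d2[OF ser]
    have val: "h x y = dseries c x y" if "series_on U h c" for h c
      using that xy by (auto simp: series_on_def)
    have "\<forall>(x, y)\<in>V. minimal_surface_eq f x y"
      using mse V(1) by blast
    moreover have "(complex_of_real \<sigma>)\<^sup>2 = 1"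
      using \<sigma> by (simp flip: of_real_power)
    ultimately show ?thesis
      using wick_rotation_zmc[OF V(3,2) _ _ rot] xy
      unfolding zero_mean_curvature_eq_def U val[OF ser1] val[OF ser2] val[OF series_on_d1[OF ser1]]
        val[OF series_on_d2[OF ser1]] val[OF series_on_d2[OF ser2]]
      by blast
  qed
  then have "zmc_solution_on U (dseries b)"
    using series_on_C2[OF ser] by (auto simp: zmc_solution_on_def)
  moreover have "\<forall>\<^sub>F (x, y) in nhds (0, 0). spacelike_at (dseries b) x y"
    using coeff0 by (intro spacelike_near_critical_point[OF ser U0]) (simp_all add: b_def)
  ultimately show ?thesis
    using U0 unfolding U_def by blast
qed

theorem theorem3p10:
  fixes f :: "real \<Rightarrow> real \<Rightarrow> real" and D :: "(real \<times> real) set"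
  assumes "open D" and "connected D" and "(0, 0) \<in> D"
    and "\<forall>(x, y)\<in>D. (- x, y) \<in> D \<and> (x, - y) \<in> D"
    and "real_analytic_on D f"
    and "\<forall>(x, y)\<in>D. minimal_surface_eq f x y"
  shows "(axes_even_on D f \<longrightarrow>
           (0, 0) \<in> wick_domain f \<and>
           (\<exists>g :: real \<Rightarrow> real \<Rightarrow> real.
              (\<forall>(x, y)\<in>wick_domain f. complex_of_real (g x y) =
                 taylor_ext f (\<i> * complex_of_real x) (\<i> * complex_of_real y)) \<and>
              zmc_solution_on (wick_domain f) g \<and>
              (\<forall>\<^sub>F (x, y) in nhds (0, 0). spacelike_at g x y))) \<and>
         (axes_odd_on D f \<longrightarrow>
           (0, 0) \<in> wick_domain f \<and>
           (\<exists>g :: real \<Rightarrow> real \<Rightarrow> real.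
              (\<forall>(x, y)\<in>wick_domain f. complex_of_real (g x y) =
                 - taylor_ext f (\<i> * complex_of_real x) (\<i> * complex_of_real y)) \<and>
              zmc_solution_on (wick_domain f) g \<and>
              (\<forall>\<^sub>F (x, y) in nhds (0, 0). spacelike_at g x y)))"
proof (intro conjI[of "_ \<longrightarrow> _"] impI)
  assume even: "axes_even_on D f"
  have "\<forall>(x, y)\<in>D. f (- x) (- y) = f x y"
  proof clarify
    fix x y
    assume "(x, y) \<in> D"
    then show "f (- x) (- y) = f x y"
      using even assms(4) unfolding axes_even_on_def by fastforce
  qed
  from wick_rotation_solution[OF assms(1,3,5,6) this, of 1]
  show "(0, 0) \<in> wick_domain f \<and>
      (\<exists>g :: real \<Rightarrow> real \<Rightarrow> real.
         (\<forall>(x, y)\<in>wick_domain f. complex_of_real (g x y) =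
            taylor_ext f (\<i> * complex_of_real x) (\<i> * complex_of_real y)) \<and>
         zmc_solution_on (wick_domain f) g \<and>
         (\<forall>\<^sub>F (x, y) in nhds (0, 0). spacelike_at g x y))"
    by simp
next
  assume odd: "axes_odd_on D f"
  have "\<forall>(x, y)\<in>D. f (- x) (- y) = f x y"
  proof clarify
    fix x y
    assume "(x, y) \<in> D"
    then show "f (- x) (- y) = f x y"
      using odd assms(4) unfolding axes_odd_on_def by fastforce
  qed
  from wick_rotation_solution[OF assms(1,3,5,6) this, of "- 1"]
  show "(0, 0) \<in> wick_domain f \<and>
      (\<exists>g :: real \<Rightarrow> real \<Rightarrow> real.
         (\<forall>(x, y)\<in>wick_domain f. complex_of_real (g x y) =
            - taylor_ext f (\<i> * complex_of_real x) (\<i> * complex_of_real y)) \<and>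
         zmc_solution_on (wick_domain f) g \<and>
         (\<forall>\<^sub>F (x, y) in nhds (0, 0). spacelike_at g x y))"
    by simp
qed

end
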